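(* Let $a<b$ be positive integers with $\gcd(a,b-1)=1$. If every $(a,b)$-biregular graph has a cyclic interval $b$-coloring, then every $(a,b-1)$-biregular graph has a cyclic interval $b$-coloring.
   Context: All graphs are finite and undirected; multiple edges are allowed, loops are not. An $(a,b)$-biregular graph is a bipartite graph with a bipartition in which all vertices of one part have degree $a$ and all vertices of the other part have degree $b$. A proper $t$-edge coloring of $G$ is a map $\alpha:E(G)\to\{1,\dots,t\}$ with $\alpha(e)\neq\alpha(e')$ for adjacent edges $e,e'$; $S(v,\alpha)$ is the set of colors on edges incident to $v$. A proper $t$-edge coloring $\alpha$ is a cyclic interval $t$-coloring if for every vertex $v$, either $S(v,\alpha)$ or $\{1,\dots,t\}\setminus S(v,\alpha)$ is a set of consecutive integers. *)

theory Defs imports Main begin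

record ('v, 'e) mgraph =
  verts :: "'v set"
  edges :: "'e set"
  ends :: "'e \<Rightarrow> 'v set"

(* Finite undirected graphs: distinct edges may have the same endpoints, and the
   requirement of exactly two endpoints excludes loops. *)
definition multigraph :: "('v, 'e) mgraph \<Rightarrow> bool" where
  "multigraph G \<longleftrightarrow> finite (verts G) \<and> finite (edges G) \<and>
     (\<forall>e\<in>edges G. ends G e \<subseteq> verts G \<and> card (ends G e) = 2)"

definition incident_edges :: "('v, 'e) mgraph \<Rightarrow> 'v \<Rightarrow> 'e set" where
  "incident_edges G v = {e \<in> edges G. v \<in> ends G e}"

definition degree :: "('v, 'e) mgraph \<Rightarrow> 'v \<Rightarrow> nat" where
  "degree G v = card (incident_edges G v)"

definition adjacent_edges :: "('v, 'e) mgraph \<Rightarrow> 'e \<Rightarrow> 'e \<Rightarrow> bool" where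
  "adjacent_edges G e f \<longleftrightarrow>
     e \<in> edges G \<and> f \<in> edges G \<and> e \<noteq> f \<and> ends G e \<inter> ends G f \<noteq> {}"

definition bipartition :: "('v, 'e) mgraph \<Rightarrow> 'v set \<Rightarrow> 'v set \<Rightarrow> bool" where
  "bipartition G X Y \<longleftrightarrow> X \<union> Y = verts G \<and> X \<inter> Y = {} \<and>
     (\<forall>e\<in>edges G. \<exists>x\<in>X. \<exists>y\<in>Y. ends G e = {x, y})"

definition biregular :: "nat \<Rightarrow> nat \<Rightarrow> ('v, 'e) mgraph \<Rightarrow> bool" where
  "biregular a b G \<longleftrightarrow> multigraph G \<and>
     (\<exists>X Y. bipartition G X Y \<and> (\<forall>x\<in>X. degree G x = a) \<and> (\<forall>y\<in>Y. degree G y = b))"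

definition proper_edge_coloring :: "('v, 'e) mgraph \<Rightarrow> nat \<Rightarrow> ('e \<Rightarrow> nat) \<Rightarrow> bool" where
  "proper_edge_coloring G t \<alpha> \<longleftrightarrow> \<alpha> ` edges G \<subseteq> {1..t} \<and>
     (\<forall>e f. adjacent_edges G e f \<longrightarrow> \<alpha> e \<noteq> \<alpha> f)"

definition color_set :: "('v, 'e) mgraph \<Rightarrow> ('e \<Rightarrow> nat) \<Rightarrow> 'v \<Rightarrow> nat set" where
  "color_set G \<alpha> v = \<alpha> ` incident_edges G v"

(* The empty set counts as consecutive. This does not affect the definition below,
   since the complement of the empty set is the set of all colors 1, ..., t. *)
definition consecutive :: "nat set \<Rightarrow> bool" where
  "consecutive S \<longleftrightarrow> (\<exists>i j. S = {i..j})"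

definition cyclic_interval_coloring :: "('v, 'e) mgraph \<Rightarrow> nat \<Rightarrow> ('e \<Rightarrow> nat) \<Rightarrow> bool" where
  "cyclic_interval_coloring G t \<alpha> \<longleftrightarrow> proper_edge_coloring G t \<alpha> \<and>
     (\<forall>v\<in>verts G. consecutive (color_set G \<alpha> v) \<or> consecutive ({1..t} - color_set G \<alpha> v))"

end

theory Submission imports Defs begin

text \<open>Counting edges from both sides and using \<open>gcd a (b - 1) = 1\<close>, the part \<open>Y\<close> of vertices of
  degree \<open>b - 1\<close> has \<open>a * k\<close> elements for some \<open>k\<close>. Split \<open>Y\<close> into \<open>k\<close> blocks of size \<open>a\<close> and join
  all vertices of each block to a new vertex: the result is \<open>(a, b)\<close>-biregular. A cyclic interval
  \<open>b\<close>-coloring of it uses all \<open>b\<close> colors at each vertex of \<open>Y\<close>, so deleting the new edges removes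
  exactly one color there, and it changes nothing at the other old vertices.\<close>

section \<open>Double counting of edges, and splitting a finite set into equal blocks\<close>

lemma bipartition_sym: "bipartition G X Y \<Longrightarrow> bipartition G Y X"
  by (simp add: bipartition_def Un_commute Int_commute) (metis insert_commute)

lemma finite_incident_edges: "multigraph G \<Longrightarrow> finite (incident_edges G v)"
  by (simp add: multigraph_def incident_edges_def)

text \<open>Every edge has exactly one end in \<open>X\<close>, so the sets of edges at the vertices
  of \<open>X\<close> partition the edge set.\<close>

lemma card_edges_bipartition:
  assumes "multigraph G" "bipartition G X Y"
  shows "card (edges G) = (\<Sum>x\<in>X. degree G x)"
proof -
  have "finite X"
    using assms by (metis multigraph_def bipartition_def finite_Un)
  have "edges G = (\<Union>x\<in>X. incident_edges G x)"
    using assms(2) by (fastforce simp: bipartition_def incident_edges_def)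
  moreover have "incident_edges G x \<inter> incident_edges G x' = {}"
    if "x \<in> X" "x' \<in> X" "x \<noteq> x'" for x x'
    using assms(2) that by (fastforce simp: bipartition_def incident_edges_def)
  ultimately show ?thesis
    using \<open>finite X\<close> finite_incident_edges[OF assms(1)]
    by (simp add: card_UN_disjoint degree_def)
qed

text \<open>Counting the edges from \<open>X\<close> and from \<open>Y\<close> gives
  \<open>card X * a = card Y * c\<close>; thus \<open>a\<close> divides \<open>card Y * c\<close>,
  and coprimality cancels \<open>c\<close>.\<close>

lemma biregular_part_card:
  assumes "multigraph G" "bipartition G X Y"
    and "\<forall>x\<in>X. degree G x = a" "\<forall>y\<in>Y. degree G y = c" and "coprime a c"
  shows "a dvd card Y"
proof -
  have "card X * a = card Y * c"
    using card_edges_bipartition[OF assms(1,2)]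
      card_edges_bipartition[OF assms(1) bipartition_sym[OF assms(2)]] assms(3,4) by simp
  then show ?thesis
    using \<open>coprime a c\<close> by (metis coprime_dvd_mult_left_iff dvd_triv_right)
qed

text \<open>The function \<open>g\<close> names the block of each element. A bijection of
  \<open>Y\<close> with a grid of \<open>k\<close> columns of size \<open>a\<close> exists by
  cardinality; the column number serves as \<open>g\<close>, so its fibres are the blocks.\<close>

lemma finite_equal_blocks:
  assumes "finite Y" "card Y = a * k"
  obtains g :: "'a \<Rightarrow> nat"
  where "g ` Y \<subseteq> {..<k}" "\<And>i. i < k \<Longrightarrow> card {y \<in> Y. g y = i} = a"
proof -
  have "card Y = card ({..<k} \<times> {..<a})"
    using assms(2) by (simp add: card_cartesian_product)
  then obtain h where h: "bij_betw h Y ({..<k} \<times> {..<a})"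
    using finite_same_card_bij[of Y "{..<k} \<times> {..<a}"] assms(1) by auto
  have "card {y \<in> Y. fst (h y) = i} = a" if "i < k" for i
  proof -
    have "h ` {y \<in> Y. fst (h y) = i} = {p \<in> h ` Y. fst p = i}"
      by auto
    also have "\<dots> = {i} \<times> {..<a}"
      unfolding bij_betw_imp_surj_on[OF h] using \<open>i < k\<close> by auto
    finally have "card (h ` {y \<in> Y. fst (h y) = i}) = a"
      by simp
    moreover have "inj_on h {y \<in> Y. fst (h y) = i}"
      using bij_betw_imp_inj_on[OF h] by (rule inj_on_subset) auto
    ultimately show ?thesis
      by (simp add: card_image)
  qed
  moreover have "(\<lambda>y. fst (h y)) ` Y \<subseteq> {..<k}"
    using bij_betwE[OF h] by auto
  ultimately show thesis
    by (intro that[of "\<lambda>y. fst (h y)"])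
qed

section \<open>Isomorphic copies of a multigraph over other types\<close>

definition relabel ::
  "('v \<Rightarrow> 'w) \<Rightarrow> ('e \<Rightarrow> 'f) \<Rightarrow> ('v, 'e) mgraph \<Rightarrow> ('w, 'f) mgraph" where
  "relabel f g G = \<lparr>verts = f ` verts G, edges = g ` edges G,
     ends = (\<lambda>e. f ` ends G (inv_into (edges G) g e))\<rparr>"

context
  fixes f :: "'v \<Rightarrow> 'w" and g :: "'e \<Rightarrow> 'f" and G :: "('v, 'e) mgraph"
  assumes inj_f: "inj_on f (verts G)" and inj_g: "inj_on g (edges G)"
    and mg: "multigraph G"
begin

text \<open>Since \<open>g\<close> is injective on the edges, \<open>inv_into\<close> recovers the
  original edge from its new name; elsewhere the value of \<open>ends\<close> is arbitrary.\<close>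

lemma ends_relabel: "e \<in> edges G \<Longrightarrow> ends (relabel f g G) (g e) = f ` ends G e"
  by (simp add: relabel_def inj_g)

lemma incident_edges_relabel:
  assumes "v \<in> verts G"
  shows "incident_edges (relabel f g G) (f v) = g ` incident_edges G v"
proof -
  \<comment> \<open>Ends lie in \<open>verts G\<close>, where \<open>f\<close> is injective, so no
    other vertex can be mapped to \<open>f v\<close>.\<close>
  have "f v \<in> f ` ends G e \<longleftrightarrow> v \<in> ends G e" if "e \<in> edges G" for e
    using mg that assms inj_f by (meson multigraph_def inj_on_image_mem_iff)
  moreover have "edges (relabel f g G) = g ` edges G"
    by (simp add: relabel_def)
  ultimately show ?thesis
    by (auto simp: incident_edges_def ends_relabel)
qed

lemma degree_relabel: "v \<in> verts G \<Longrightarrow> degree (relabel f g G) (f v) = degree G v"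
  unfolding degree_def incident_edges_relabel
  by (rule card_image, rule inj_on_subset[OF inj_g]) (auto simp: incident_edges_def)

lemma multigraph_relabel: "multigraph (relabel f g G)"
proof -
  have "f ` ends G e \<subseteq> f ` verts G \<and> card (f ` ends G e) = 2" if "e \<in> edges G" for e
    using mg that inj_f by (metis multigraph_def card_image image_mono inj_on_subset)
  then show ?thesis
    using mg ends_relabel by (auto simp: multigraph_def relabel_def)
qed

lemma bipartition_relabel:
  assumes "bipartition G X Y"
  shows "bipartition (relabel f g G) (f ` X) (f ` Y)"
  unfolding bipartition_def
proof (intro conjI ballI)
  show "f ` X \<union> f ` Y = verts (relabel f g G)"
    using assms by (simp add: bipartition_def relabel_def flip: image_Un)
  show "f ` X \<inter> f ` Y = {}"
    using assms inj_f inj_on_image_Int[of f "verts G" X Y] unfolding bipartition_def by auto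
next
  fix e' assume "e' \<in> edges (relabel f g G)"
  then obtain e where e: "e \<in> edges G" "e' = g e" by (auto simp: relabel_def)
  then obtain x y where "x \<in> X" "y \<in> Y" "ends G e = {x, y}"
    using assms unfolding bipartition_def by blast
  then show "\<exists>x\<in>f ` X. \<exists>y\<in>f ` Y. ends (relabel f g G) e' = {x, y}"
    using e ends_relabel by auto
qed

lemma biregular_relabel:
  assumes "biregular a b G"
  shows "biregular a b (relabel f g G)"
proof -
  obtain X Y where XY: "bipartition G X Y" "\<forall>x\<in>X. degree G x = a" "\<forall>y\<in>Y. degree G y = b"
    using assms unfolding biregular_def by blast
  then have "X \<subseteq> verts G" "Y \<subseteq> verts G" by (auto simp: bipartition_def)
  then have "\<forall>x\<in>f ` X. degree (relabel f g G) x = a" "\<forall>y\<in>f ` Y. degree (relabel f g G) y = b"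
    using XY by (auto simp: degree_relabel subset_iff)
  then show ?thesis
    using multigraph_relabel bipartition_relabel[OF XY(1)] unfolding biregular_def by blast
qed

text \<open>Adjacent edges have adjacent images, and the color set at \<open>f v\<close> is the one
  that \<open>\<alpha> \<circ> g\<close> has at \<open>v\<close>. Hence both coloring conditions
  pull back.\<close>

lemma cyclic_interval_coloring_relabel:
  assumes "cyclic_interval_coloring (relabel f g G) t \<alpha>"
  shows "cyclic_interval_coloring G t (\<alpha> \<circ> g)"
proof -
  have "adjacent_edges (relabel f g G) (g e) (g e')" if "adjacent_edges G e e'" for e e'
  proof -
    have "e \<in> edges G" "e' \<in> edges G" "e \<noteq> e'" "ends G e \<inter> ends G e' \<noteq> {}"
      using that by (auto simp: adjacent_edges_def)
    moreover from this have "g e \<noteq> g e'" using inj_g by (meson inj_on_eq_iff)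
    moreover have "edges (relabel f g G) = g ` edges G" by (simp add: relabel_def)
    ultimately show ?thesis
      unfolding adjacent_edges_def by (auto simp: ends_relabel)
  qed
  moreover have "color_set (relabel f g G) \<alpha> (f v) = color_set G (\<alpha> \<circ> g) v"
    if "v \<in> verts G" for v
    using that by (simp add: color_set_def incident_edges_relabel image_comp)
  ultimately show ?thesis
    using assms unfolding cyclic_interval_coloring_def proper_edge_coloring_def
    by (auto simp: relabel_def image_comp)
qed

end

text \<open>An assumption cannot quantify over types, so the hypothesis on all biregular graphs is
  stated over \<open>nat\<close>. It reaches graphs over any types, such as the sum types below,
  because a finite graph has a copy over \<open>nat\<close>.\<close>

lemma cyclic_interval_coloring_nat_transfer:
  fixes G :: "('v, 'e) mgraph"
  assumes "\<forall>H :: (nat, nat) mgraph. biregular a b H \<longrightarrow> (\<exists>\<alpha>. cyclic_interval_coloring H t \<alpha>)"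
    and "biregular a b G"
  shows "\<exists>\<alpha>. cyclic_interval_coloring G t \<alpha>"
proof -
  have mg: "multigraph G" using assms(2) by (simp add: biregular_def)
  then obtain f :: "'v \<Rightarrow> nat" and g :: "'e \<Rightarrow> nat"
    where fg: "inj_on f (verts G)" "inj_on g (edges G)"
    by (metis multigraph_def finite_imp_inj_to_nat_seg)
  show ?thesis
    using assms biregular_relabel[OF fg mg] cyclic_interval_coloring_relabel[OF fg mg] by blast
qed

section \<open>Colors at a vertex, and the graph with one new edge at each vertex of
  \<open>Y\<close>\<close>

lemma proper_edge_coloring_inj_on_incident:
  assumes "proper_edge_coloring G t \<alpha>"
  shows "inj_on \<alpha> (incident_edges G v)"
  using assms
  by (fastforce simp: proper_edge_coloring_def adjacent_edges_def incident_edges_def inj_on_def)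

text \<open>The \<open>t\<close> edges at \<open>v\<close> receive distinct colors from a palette of
  size \<open>t\<close>, so they exhaust it.\<close>

lemma color_set_full_degree:
  assumes "proper_edge_coloring G t \<alpha>" "degree G v = t"
  shows "color_set G \<alpha> v = {1..t}"
proof (rule card_subset_eq)
  show "color_set G \<alpha> v \<subseteq> {1..t}"
    using assms(1) by (auto simp: color_set_def proper_edge_coloring_def incident_edges_def)
  show "card (color_set G \<alpha> v) = card {1..t}"
    using assms proper_edge_coloring_inj_on_incident[OF assms(1)]
    by (simp add: color_set_def degree_def card_image)
qed simp

text \<open>Each \<open>y\<close> in \<open>Y\<close> gets exactly one new edge, which can therefore
  be named by \<open>y\<close> itself: \<open>Inr y\<close> joins \<open>y\<close> to the new vertex
  of its block \<open>g y\<close>. This is why the edge type is \<open>'e + 'v\<close>.\<close>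

definition attach :: "('v, 'e) mgraph \<Rightarrow> 'v set \<Rightarrow> ('v \<Rightarrow> nat) \<Rightarrow> nat
    \<Rightarrow> ('v + nat, 'e + 'v) mgraph" where
  "attach G Y g k = \<lparr>verts = verts G <+> {..<k}, edges = edges G <+> Y,
     ends = case_sum (\<lambda>e. Inl ` ends G e) (\<lambda>y. {Inl y, Inr (g y)})\<rparr>"

lemma incident_edges_attach_Inl:
  "incident_edges (attach G Y g k) (Inl v)
     = Inl ` incident_edges G v \<union> (if v \<in> Y then {Inr v} else {})"
  by (auto simp: incident_edges_def attach_def)

lemma incident_edges_attach_Inr:
  "incident_edges (attach G Y g k) (Inr i) = Inr ` {y \<in> Y. g y = i}"
  by (auto simp: incident_edges_def attach_def)

lemma degree_attach_Inl:
  assumes "multigraph G"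
  shows "degree (attach G Y g k) (Inl v) = degree G v + (if v \<in> Y then 1 else 0)"
proof -
  have "Inr v \<notin> Inl ` incident_edges G v" by auto
  then show ?thesis
    using finite_incident_edges[OF assms]
    by (simp add: degree_def incident_edges_attach_Inl card_image)
qed

lemma multigraph_attach:
  assumes "multigraph G" "Y \<subseteq> verts G" "g ` Y \<subseteq> {..<k}"
  shows "multigraph (attach G Y g k)"
proof -
  have "finite Y" using assms finite_subset by (auto simp: multigraph_def)
  moreover have "ends (attach G Y g k) e \<subseteq> verts (attach G Y g k)
      \<and> card (ends (attach G Y g k) e) = 2" if "e \<in> edges (attach G Y g k)" for e
  proof (cases e)
    case (Inl e')
    then have "e' \<in> edges G" using that by (auto simp: attach_def)
    then have "ends G e' \<subseteq> verts G" "card (ends G e') = 2"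
      using assms(1) by (auto simp: multigraph_def)
    then show ?thesis
      using Inl by (auto simp: attach_def card_image)
  next
    case (Inr y)
    then have "y \<in> Y" using that by (auto simp: attach_def)
    then show ?thesis
      using Inr assms(2,3) by (auto simp: attach_def)
  qed
  ultimately show ?thesis
    using assms(1) by (simp add: multigraph_def attach_def)
qed

text \<open>A new edge has its old end in \<open>Y\<close>, so the new vertices must join the side
  of \<open>X\<close>. In the application this is the side of degree \<open>a\<close>, the size of a
  block.\<close>

lemma bipartition_attach:
  assumes "bipartition G X Y" "g ` Y \<subseteq> {..<k}"
  shows "bipartition (attach G Y g k) (X <+> {..<k}) (Inl ` Y)"
  unfolding bipartition_def
proof (intro conjI ballI)
  show "(X <+> {..<k}) \<union> Inl ` Y = verts (attach G Y g k)"
    using assms by (auto simp: bipartition_def attach_def)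
  show "(X <+> {..<k}) \<inter> Inl ` Y = {}"
    using assms by (auto simp: bipartition_def)
next
  fix e assume "e \<in> edges (attach G Y g k)"
  then consider e' where "e' \<in> edges G" "e = Inl e'" | y where "y \<in> Y" "e = Inr y"
    by (auto simp: attach_def)
  then show "\<exists>x\<in>X <+> {..<k}. \<exists>y\<in>Inl ` Y. ends (attach G Y g k) e = {x, y}"
  proof cases
    case 1
    then obtain x y where "x \<in> X" "y \<in> Y" "ends G e' = {x, y}"
      using assms(1) unfolding bipartition_def by blast
    with 1 show ?thesis
      by (auto simp: attach_def intro!: bexI[of _ "Inl x"])
  next
    case 2
    with assms(2) show ?thesis
      by (auto simp: attach_def intro!: bexI[of _ "Inr (g y)"])
  qed
qed

text \<open>The coloring is restricted to the old edges. Vertices outside \<open>Y\<close> keep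
  their color sets; a vertex of \<open>Y\<close> sees all \<open>t\<close> colors before the
  restriction and loses one. Writing \<open>degree G y + 1 = t\<close> avoids truncated
  subtraction.\<close>

lemma cyclic_interval_coloring_detach:
  assumes "multigraph G" "cyclic_interval_coloring (attach G Y g k) t \<alpha>"
    and "\<And>y. y \<in> Y \<Longrightarrow> degree G y + 1 = t"
  shows "cyclic_interval_coloring G t (\<alpha> \<circ> Inl)"
proof -
  let ?H = "attach G Y g k"
  have proper: "proper_edge_coloring ?H t \<alpha>"
    using assms(2) by (simp add: cyclic_interval_coloring_def)
  have "adjacent_edges ?H (Inl e) (Inl e')" if "adjacent_edges G e e'" for e e'
    using that by (auto simp: adjacent_edges_def attach_def)
  then have "proper_edge_coloring G t (\<alpha> \<circ> Inl)"
    using proper by (auto simp: proper_edge_coloring_def attach_def)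
  moreover have "consecutive (color_set G (\<alpha> \<circ> Inl) v)
      \<or> consecutive ({1..t} - color_set G (\<alpha> \<circ> Inl) v)" if "v \<in> verts G" for v
  proof (cases "v \<in> Y")
    case True
    let ?c = "\<alpha> (Inr v)"
    have "degree ?H (Inl v) = t"
      using assms True by (simp add: degree_attach_Inl)
    then have "color_set ?H \<alpha> (Inl v) = {1..t}"
      by (rule color_set_full_degree[OF proper])
    moreover have "color_set ?H \<alpha> (Inl v) = insert ?c (color_set G (\<alpha> \<circ> Inl) v)"
      using True by (simp add: color_set_def incident_edges_attach_Inl image_comp)
    moreover have "?c \<notin> color_set G (\<alpha> \<circ> Inl) v"
      using proper_edge_coloring_inj_on_incident[OF proper, of "Inl v"] True
      by (auto simp: color_set_def incident_edges_attach_Inl inj_on_def)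
    \<comment> \<open>The color \<open>?c\<close> of the deleted edge is the only one missing at
      \<open>v\<close>, and a singleton is an interval, so the complement is consecutive.\<close>
    ultimately have "{1..t} - color_set G (\<alpha> \<circ> Inl) v = {?c..?c}"
      by (metis Diff_cancel Diff_insert_absorb atLeastAtMost_singleton insert_Diff_if)
    then show ?thesis unfolding consecutive_def by blast
  next
    case False
    then have "color_set ?H \<alpha> (Inl v) = color_set G (\<alpha> \<circ> Inl) v"
      by (simp add: color_set_def incident_edges_attach_Inl image_comp)
    moreover have "Inl v \<in> verts ?H" using that by (auto simp: attach_def)
    ultimately show ?thesis
      using assms(2) unfolding cyclic_interval_coloring_def by metis
  qed
  ultimately show ?thesis by (simp add: cyclic_interval_coloring_def)
qed

theorem theorem4:
  fixes a b :: nat and G :: "('v, 'e) mgraph"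
  assumes "0 < a" and "a < b" and "gcd a (b - 1) = 1"
    and "\<forall>H :: (nat, nat) mgraph. biregular a b H \<longrightarrow> (\<exists>\<alpha>. cyclic_interval_coloring H b \<alpha>)"
    and "biregular a (b - 1) G"
  shows "\<exists>\<alpha>. cyclic_interval_coloring G b \<alpha>"
proof -
  obtain X Y where mg: "multigraph G" and XY: "bipartition G X Y"
    and X: "\<forall>x\<in>X. degree G x = a" and Y: "\<forall>y\<in>Y. degree G y = b - 1"
    using assms(5) unfolding biregular_def by blast
  have disj: "X \<inter> Y = {}" and sub: "Y \<subseteq> verts G"
    using XY by (auto simp: bipartition_def)
  have "finite Y"
    using mg sub by (auto simp: multigraph_def intro: finite_subset)
  obtain k where "card Y = a * k"
    using biregular_part_card[OF mg XY X Y] assms(3) by (metis coprime_iff_gcd_eq_1 dvdE)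
  then obtain g where g: "g ` Y \<subseteq> {..<k}" "\<And>i. i < k \<Longrightarrow> card {y \<in> Y. g y = i} = a"
    using finite_equal_blocks[OF \<open>finite Y\<close>] by blast
  let ?H = "attach G Y g k"
  \<comment> \<open>A new vertex has one edge for each of the \<open>a\<close> members of its block;
    a vertex of \<open>X\<close> gains no edge because it is not in \<open>Y\<close>.\<close>
  have "degree ?H x = a" if "x \<in> X <+> {..<k}" for x
    using that
  proof (rule PlusE)
    fix i assume "i \<in> {..<k}" "x = Inr i"
    then show ?thesis
      using g(2) by (simp add: degree_def incident_edges_attach_Inr card_image)
  next
    fix v assume "v \<in> X" "x = Inl v"
    then show ?thesis
      using X disj by (auto simp: degree_attach_Inl[OF mg])
  qed
  \<comment> \<open>The new edge raises the degree to \<open>b - 1 + 1\<close>, which equals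
    \<open>b\<close> because \<open>a < b\<close> forces \<open>b\<close> to be positive.\<close>
  moreover have "degree ?H y = b" if "y \<in> Inl ` Y" for y
    using that Y assms(2) by (auto simp: degree_attach_Inl[OF mg])
  ultimately have "biregular a b ?H"
    using multigraph_attach[OF mg sub g(1)] bipartition_attach[OF XY g(1)]
    unfolding biregular_def by blast
  \<comment> \<open>The graph \<open>?H\<close> lives over sum types, so the hypothesis applies to
    it only through a copy over \<open>nat\<close>.\<close>
  then obtain \<alpha> where "cyclic_interval_coloring ?H b \<alpha>"
    using cyclic_interval_coloring_nat_transfer[OF assms(4)] by blast
  then show ?thesis
    using cyclic_interval_coloring_detach[OF mg] Y assms(2) by fastforce
qed

end
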